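(* There is a square-free monomial ideal $I$ in some polynomial ring $R$ over a field such that neither the sequence $\{\operatorname{assrad}(I^{(s)})\}_{s\ge 1}$ nor the sequence $\{\operatorname{assrad}(I^s)\}_{s\ge 1}$ is increasing in $s$; that is, it is not true that $\operatorname{assrad}(I^{(s)})\subseteq\operatorname{assrad}(I^{(s+1)})$ for all $s\ge 1$, and it is not true that $\operatorname{assrad}(I^{s})\subseteq\operatorname{assrad}(I^{s+1})$ for all $s\ge 1$.
   Context: For a monomial ideal $I$ of a polynomial ring $R$ over a field, $\operatorname{assrad}(I)=\{\sqrt{I:f}\mid f \text{ is a monomial of } R,\ f\notin I\}$ denotes the set of associated radical ideals of $I$. For $s\ge 1$ the $s$-th symbolic power of $I$ is $I^{(s)}=\bigcap_{\mathfrak p\in \operatorname{Min}(I)} (I^sR_{\mathfrak p}\cap R)$, where $\operatorname{Min}(I)$ is the set of minimal primes of $I$. *)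

theory Defs
  imports
    "HOL-Library.Poly_Mapping"
    "HOL-Computational_Algebra.Fraction_Field"
    "HOL-Algebra.Ideal_Product"
begin

text \<open>
  A polynomial is a finitely supported map from exponent vectors to coefficients; the product on
  \<open>\<Rightarrow>\<^sub>0\<close> is convolution. The type has variables indexed by all natural numbers, so the polynomial
  ring in the \<open>n\<close> variables with indices \<open>0, \<dots>, n - 1\<close> is carved out by its carrier.
\<close>

type_synonym exponent = "nat \<Rightarrow>\<^sub>0 nat"
type_synonym 'k mpoly = "(nat \<Rightarrow>\<^sub>0 nat) \<Rightarrow>\<^sub>0 'k"

definition exponents :: "nat \<Rightarrow> exponent set" where
  "exponents n = {a. Poly_Mapping.keys a \<subseteq> {..<n}}"

definition mpoly_ring :: "nat \<Rightarrow> 'k::field mpoly ring" where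
  "mpoly_ring n =
    \<lparr>carrier = {f. Poly_Mapping.keys f \<subseteq> exponents n},
     mult = (*), one = 1, zero = 0, add = (+)\<rparr>"

definition monom :: "exponent \<Rightarrow> 'k::field mpoly" where
  "monom a = Poly_Mapping.single a 1"

definition squarefree_monomial_ideal :: "nat \<Rightarrow> 'k::field mpoly set \<Rightarrow> bool" where
  "squarefree_monomial_ideal n I \<longleftrightarrow>
    (\<exists>A \<subseteq> exponents n. (\<forall>a\<in>A. \<forall>i. Poly_Mapping.lookup a i \<le> 1) \<and>
      I = Idl\<^bsub>mpoly_ring n\<^esub> (monom ` A))"

definition ideal_power :: "('a, 'b) ring_scheme \<Rightarrow> 'a set \<Rightarrow> nat \<Rightarrow> 'a set" where
  "ideal_power R I s = I [^]\<^bsub>ideals_set R\<^esub> s"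

definition radical :: "('a, 'b) ring_scheme \<Rightarrow> 'a set \<Rightarrow> 'a set" where
  "radical R I = {g \<in> carrier R. \<exists>m::nat. g [^]\<^bsub>R\<^esub> m \<in> I}"

definition colon :: "('a, 'b) ring_scheme \<Rightarrow> 'a set \<Rightarrow> 'a \<Rightarrow> 'a set" where
  "colon R I f = {g \<in> carrier R. g \<otimes>\<^bsub>R\<^esub> f \<in> I}"

definition assrad :: "nat \<Rightarrow> 'k::field mpoly set \<Rightarrow> 'k mpoly set set" where
  "assrad n I =
    {radical (mpoly_ring n) (colon (mpoly_ring n) I (monom a)) | a.
      a \<in> exponents n \<and> monom a \<notin> I}"

definition minimal_primes :: "('a, 'b) ring_scheme \<Rightarrow> 'a set \<Rightarrow> 'a set set" where
  "minimal_primes R I =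
    {p. primeideal p R \<and> I \<subseteq> p \<and> (\<forall>q. primeideal q R \<and> I \<subseteq> q \<and> q \<subseteq> p \<longrightarrow> q = p)}"

text \<open>
  The localization at a prime \<open>p\<close>, as the subring of the field of fractions (the polynomial ring
  is a domain) consisting of the fractions with denominator outside \<open>p\<close>.
\<close>

definition localization :: "nat \<Rightarrow> 'k::field mpoly set \<Rightarrow> 'k mpoly fract ring" where
  "localization n p =
    \<lparr>carrier = {Fract a b | a b. a \<in> carrier (mpoly_ring n) \<and> b \<in> carrier (mpoly_ring n) - p},
     mult = (*), one = 1, zero = 0, add = (+)\<rparr>"

definition localized_ideal :: "nat \<Rightarrow> 'k::field mpoly set \<Rightarrow> 'k mpoly set \<Rightarrow> 'k mpoly fract set" where
  "localized_ideal n p J = Idl\<^bsub>localization n p\<^esub> ((\<lambda>f. Fract f 1) ` J)"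

text \<open>
  Membership in \<open>carrier\<close> is stated separately so that the empty intersection (\<open>I = R\<close>) is \<open>R\<close>.
\<close>

definition symbolic_power :: "nat \<Rightarrow> 'k::field mpoly set \<Rightarrow> nat \<Rightarrow> 'k mpoly set" where
  "symbolic_power n I s =
    {f \<in> carrier (mpoly_ring n).
      \<forall>p \<in> minimal_primes (mpoly_ring n) I.
        Fract f 1 \<in> localized_ideal n p (ideal_power (mpoly_ring n) I s)}"

text \<open>
  These facts guarantee that the library's ideal notions, which are relative to a ring structure,
  are not degenerate for the two structures above.
\<close>

lemma exponents_add: "a \<in> exponents n \<Longrightarrow> b \<in> exponents n \<Longrightarrow> a + b \<in> exponents n"
  using Poly_Mapping.keys_add[of a b] by (auto simp: exponents_def)

lemma cring_mpoly_ring: "cring (mpoly_ring n :: 'k::field mpoly ring)"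
proof (rule cringI)
  let ?R = "mpoly_ring n :: 'k mpoly ring"
  have add: "f + g \<in> carrier ?R" if "f \<in> carrier ?R" "g \<in> carrier ?R" for f g
    using that Poly_Mapping.keys_add[of f g] by (auto simp: mpoly_ring_def)
  have mult: "f * g \<in> carrier ?R" if "f \<in> carrier ?R" "g \<in> carrier ?R" for f g
  proof -
    have "Poly_Mapping.keys (f * g) \<subseteq> exponents n"
      using that Poly_Mapping.keys_mult[of f g] exponents_add
      by (fastforce simp: mpoly_ring_def)
    then show ?thesis by (simp add: mpoly_ring_def)
  qed
  show "abelian_group ?R"
  proof (rule abelian_groupI)
    fix f assume "f \<in> carrier ?R"
    then show "\<exists>g\<in>carrier ?R. g \<oplus>\<^bsub>?R\<^esub> f = \<zero>\<^bsub>?R\<^esub>"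
      by (intro bexI[of _ "- f"]) (auto simp: mpoly_ring_def)
  qed (use add in \<open>auto simp: mpoly_ring_def algebra_simps\<close>)
  show "comm_monoid ?R"
    by (rule comm_monoidI) (use mult in \<open>auto simp: mpoly_ring_def exponents_def algebra_simps\<close>)
qed (auto simp: mpoly_ring_def algebra_simps)

lemma cring_localization:
  fixes p :: "'k::field mpoly set"
  assumes "primeideal p (mpoly_ring n)"
  shows "cring (localization n p)"
proof -
  let ?R = "mpoly_ring n :: 'k mpoly ring" and ?L = "localization n p"
  interpret R: cring ?R by (rule cring_mpoly_ring)
  interpret p: primeideal p ?R by (rule assms)
  have R: "x \<otimes>\<^bsub>?R\<^esub> y = x * y" "x \<oplus>\<^bsub>?R\<^esub> y = x + y" "\<one>\<^bsub>?R\<^esub> = 1" "\<zero>\<^bsub>?R\<^esub> = 0" for x y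
    by (simp_all add: mpoly_ring_def)
  note closed = R.m_closed[unfolded R] R.a_closed[unfolded R] R.one_closed[unfolded R]
    R.zero_closed[unfolded R]
  have L: "x \<otimes>\<^bsub>?L\<^esub> y = x * y" "x \<oplus>\<^bsub>?L\<^esub> y = x + y" "\<one>\<^bsub>?L\<^esub> = 1" "\<zero>\<^bsub>?L\<^esub> = 0" for x y
    by (simp_all add: localization_def)
  define D where "D = carrier ?R - p"
  have carr: "x \<in> carrier ?L \<longleftrightarrow> (\<exists>a b. x = Fract a b \<and> a \<in> carrier ?R \<and> b \<in> D)" for x
    by (auto simp: localization_def D_def)
  have D0: "b \<noteq> 0" if "b \<in> D" for b
    using that p.zero_closed by (auto simp: D_def R)
  have D1: "1 \<in> D"
    using p.one_imp_carrier p.I_notcarr closed(3) by (auto simp: D_def R)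
  have Dmult: "b * d \<in> D" if "b \<in> D" "d \<in> D" for b d
    using that p.I_prime[of b d] closed(1)[of b d] by (auto simp: D_def R)
  have DR: "b \<in> carrier ?R" if "b \<in> D" for b
    using that by (simp add: D_def)
  have add: "x + y \<in> carrier ?L" if xy: "x \<in> carrier ?L" "y \<in> carrier ?L" for x y
  proof -
    obtain a b c d where *: "x = Fract a b" "a \<in> carrier ?R" "b \<in> D"
      "y = Fract c d" "c \<in> carrier ?R" "d \<in> D"
      using xy by (auto simp: carr)
    then have "x + y = Fract (a * d + c * b) (b * d)" by (simp add: D0)
    moreover have "a * d + c * b \<in> carrier ?R" using * DR by (intro closed)
    ultimately show ?thesis using * Dmult unfolding carr by blast
  qed
  have mult: "x * y \<in> carrier ?L" if xy: "x \<in> carrier ?L" "y \<in> carrier ?L" for x y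
  proof -
    obtain a b c d where *: "x = Fract a b" "a \<in> carrier ?R" "b \<in> D"
      "y = Fract c d" "c \<in> carrier ?R" "d \<in> D"
      using xy by (auto simp: carr)
    then have "x * y = Fract (a * c) (b * d)" by simp
    moreover have "a * c \<in> carrier ?R" using * by (intro closed)
    ultimately show ?thesis using * Dmult unfolding carr by blast
  qed
  have zero: "0 \<in> carrier ?L" and one: "1 \<in> carrier ?L"
    using D1 closed(3,4) unfolding carr Zero_fract_def One_fract_def by blast+
  have minus: "- x \<in> carrier ?L" if x: "x \<in> carrier ?L" for x
  proof -
    obtain a b where *: "x = Fract a b" "a \<in> carrier ?R" "b \<in> D"
      using x by (auto simp: carr)
    then have "- a \<in> carrier ?R" by (simp add: mpoly_ring_def)
    moreover have "- x = Fract (- a) b" using * by simp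
    ultimately show ?thesis using * unfolding carr by blast
  qed
  show ?thesis
  proof (rule cringI)
    show "abelian_group ?L"
    proof (rule abelian_groupI)
      fix x assume "x \<in> carrier ?L"
      then show "\<exists>y\<in>carrier ?L. y \<oplus>\<^bsub>?L\<^esub> x = \<zero>\<^bsub>?L\<^esub>"
        by (intro bexI[of _ "- x"]) (simp_all add: L minus)
    qed (simp_all add: L add zero algebra_simps)
    show "comm_monoid ?L"
      by (rule comm_monoidI) (simp_all add: L mult one algebra_simps)
  qed (simp add: L algebra_simps)
qed

end

theory Submission
  imports Defs
begin

text \<open>
  The witness is the squarefree Veronese ideal \<open>I\<close> generated by the products of three distinct
  variables among five. For such an ideal, generated by the products of \<open>d\<close> distinct variables among
  \<open>n\<close>, both kinds of powers are monomial ideals with a simple description by exponent vectors. A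
  monomial \<open>x^b\<close> lies in \<open>I^s\<close> iff \<open>(\<Sum>i<n. min (b i) s) \<ge> d * s\<close> (\<open>ideal_power_veronese\<close>), and it lies
  in the \<open>s\<close>-th symbolic power iff \<open>(\<Sum>i\<in>T. b i) \<ge> s\<close> for all sets \<open>T\<close> of \<open>n - d + 1\<close> variables
  (\<open>monom_in_symbolic_power_veronese\<close>), because the minimal primes of \<open>I\<close> are generated by exactly
  these sets (\<open>minimal_primes_veronese\<close>).

  Two radicals \<open>\<surd>(J : x^a)\<close> are told apart by the squarefree monomials \<open>x_F\<close> that they contain: these
  are the \<open>x_F\<close> for which the condition for membership of \<open>x^a\<close> in \<open>J\<close> becomes true once the exponents
  at the indices in \<open>F\<close> are made arbitrarily large (\<open>in_radical_colon_symbolic_power\<close>,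
  \<open>in_radical_colon_power\<close>). So each assertion turns into a system of linear inequalities for
  exponents.

  Take \<open>n = 5\<close>, \<open>d = 3\<close> and \<open>a = (0,1,1,1,1)\<close>. The radical that \<open>a\<close> gives for the third symbolic power
  comes from an exponent \<open>b\<close> for the fourth one only if any two of \<open>b 1, \<dots>, b 4\<close> have sum at most \<open>3\<close> and
  any three have sum at least \<open>4\<close>. The radical that \<open>a\<close> gives for \<open>I^2\<close> comes from an exponent \<open>b\<close> for \<open>I^3\<close>
  only if the truncations \<open>min (b i) 3\<close> satisfy inequalities that force the value at \<open>0\<close> to be \<open>0\<close>
  and any two of the other four to have sum \<open>3\<close>. Both systems are solved by the rational value \<open>3/2\<close> at
  each of these four indices, but neither has an integral solution.
\<close>

section \<open>Monomial ideals\<close>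

lemma mpoly_ring_simps [simp]:
  "x \<otimes>\<^bsub>mpoly_ring n\<^esub> y = x * y" "x \<oplus>\<^bsub>mpoly_ring n\<^esub> y = x + y"
  "\<one>\<^bsub>mpoly_ring n\<^esub> = 1" "\<zero>\<^bsub>mpoly_ring n\<^esub> = 0"
  "f \<in> carrier (mpoly_ring n) \<longleftrightarrow> Poly_Mapping.keys f \<subseteq> exponents n"
  by (simp_all add: mpoly_ring_def)

lemma mpoly_ring_pow [simp]: "g [^]\<^bsub>mpoly_ring n\<^esub> (m::nat) = g ^ m"
  by (induction m) (simp_all add: cring.cring_simprules nat_pow_def mult.commute mpoly_ring_def)

lemma keys_monom [simp]: "Poly_Mapping.keys (monom a :: 'k::field mpoly) = {a}"
  by (simp add: monom_def)

lemma monom_mult: "monom a * monom b = monom (a + b)"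
  by (simp add: monom_def mult_single)

lemma monom_0: "monom 0 = 1"
  by (simp add: monom_def)

lemma lookup_add_monom_mult:
  "Poly_Mapping.lookup (monom b * u) (b + c) = Poly_Mapping.lookup u c"
  by (simp add: lookup_mult monom_def lookup_single when_mult)

text \<open>
  Spanned by the monomials with exponents in \<open>S\<close>. It is an ideal only if \<open>S\<close> is stable under adding
  exponents, which is the predicate \<open>up_closed\<close>.
\<close>

definition monomial_ideal :: "exponent set \<Rightarrow> 'k::field mpoly set" where
  "monomial_ideal S = {f. Poly_Mapping.keys f \<subseteq> S}"

definition up_closed :: "nat \<Rightarrow> exponent set \<Rightarrow> bool" where
  "up_closed n S \<longleftrightarrow> S \<subseteq> exponents n \<and> (\<forall>a\<in>S. \<forall>c\<in>exponents n. a + c \<in> S)"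

lemma monom_in_monomial_ideal [simp]: "monom a \<in> monomial_ideal S \<longleftrightarrow> a \<in> S"
  by (simp add: monomial_ideal_def)

lemma ideal_zero: "ideal J (mpoly_ring n) \<Longrightarrow> 0 \<in> (J :: 'k::field mpoly set)"
  using additive_subgroup.zero_closed[OF ideal.axioms(1), of J "mpoly_ring n"] by simp

lemma ideal_add:
  "ideal J (mpoly_ring n) \<Longrightarrow> f \<in> J \<Longrightarrow> g \<in> J \<Longrightarrow> f + g \<in> (J :: 'k::field mpoly set)"
  using additive_subgroup.a_closed[OF ideal.axioms(1), of J "mpoly_ring n" f g] by simp

lemma ideal_uminus:
  assumes "ideal J (mpoly_ring n)" "f \<in> J"
  shows "- f \<in> (J :: 'k::field mpoly set)"
proof -
  interpret J: ideal J "mpoly_ring n" by (rule assms)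
  have "(-1 :: 'k mpoly) \<in> carrier (mpoly_ring n)"
    by (simp add: exponents_def)
  from J.I_l_closed[OF assms(2) this] show ?thesis by simp
qed

lemma ideal_monomial_ideal:
  assumes "up_closed n S"
  shows "ideal (monomial_ideal S :: 'k::field mpoly set) (mpoly_ring n)"
proof -
  interpret R: cring "mpoly_ring n :: 'k mpoly ring" by (rule cring_mpoly_ring)
  have l: "x * a \<in> monomial_ideal S"
    if "a \<in> monomial_ideal S" "Poly_Mapping.keys x \<subseteq> exponents n" for a x :: "'k mpoly"
  proof -
    have "Poly_Mapping.keys (x * a) \<subseteq> {b + c |b c. b \<in> Poly_Mapping.keys x \<and> c \<in> Poly_Mapping.keys a}"
      by (rule keys_mult)
    also have "\<dots> \<subseteq> S"
    proof clarify
      fix b c assume "b \<in> Poly_Mapping.keys x" "c \<in> Poly_Mapping.keys a"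
      then have "b \<in> exponents n" "c \<in> S"
        using that by (auto simp: monomial_ideal_def)
      then show "b + c \<in> S"
        using assms by (auto simp: up_closed_def add.commute)
    qed
    finally show ?thesis by (simp add: monomial_ideal_def)
  qed
  have "subgroup (monomial_ideal S) (add_monoid (mpoly_ring n :: 'k mpoly ring))"
  proof (rule R.add.subgroupI)
    show "monomial_ideal S \<subseteq> carrier (mpoly_ring n :: 'k mpoly ring)"
      using assms by (auto simp: monomial_ideal_def up_closed_def)
    have "(0 :: 'k mpoly) \<in> monomial_ideal S" by (simp add: monomial_ideal_def)
    then show "(monomial_ideal S :: 'k mpoly set) \<noteq> {}" by blast
  next
    fix a :: "'k mpoly" assume a: "a \<in> monomial_ideal S"
    have a': "a \<in> carrier (mpoly_ring n)"
      using a assms by (auto simp: monomial_ideal_def up_closed_def)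
    have "\<ominus>\<^bsub>mpoly_ring n\<^esub> a = - a"
      by (rule R.minus_equality) (use a' in auto)
    then show "\<ominus>\<^bsub>mpoly_ring n\<^esub> a \<in> monomial_ideal S"
      using a by (simp add: monomial_ideal_def)
  next
    fix a b :: "'k mpoly" assume "a \<in> monomial_ideal S" "b \<in> monomial_ideal S"
    then show "a \<oplus>\<^bsub>mpoly_ring n\<^esub> b \<in> monomial_ideal S"
      using Poly_Mapping.keys_add[of a b] by (auto simp: monomial_ideal_def)
  qed
  then show ?thesis
    by (intro idealI R.ring_axioms) (use l in \<open>auto simp: mult.commute\<close>)
qed

lemma monomial_ideal_subset:
  fixes J :: "'k::field mpoly set"
  assumes zero: "0 \<in> J" and add: "\<And>f g. f \<in> J \<Longrightarrow> g \<in> J \<Longrightarrow> f + g \<in> J"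
    and single: "\<And>a k. a \<in> S \<Longrightarrow> Poly_Mapping.single a k \<in> J"
  shows "monomial_ideal S \<subseteq> J"
proof
  fix f :: "'k mpoly"
  assume "f \<in> monomial_ideal S"
  then have "Poly_Mapping.keys f \<subseteq> S" by (simp add: monomial_ideal_def)
  then show "f \<in> J"
  proof (induction f rule: Poly_Mapping.update_induct)
    case const
    show ?case by (rule zero)
  next
    case (update f a b)
    have "Poly_Mapping.update a b f = Poly_Mapping.single a b + f"
      using update.hyps
      by (intro poly_mapping_eqI)
        (auto simp: lookup_update lookup_add lookup_single in_keys_iff when_def)
    moreover have "Poly_Mapping.keys (Poly_Mapping.update a b f) = insert a (Poly_Mapping.keys f)"
      using update.hyps by (auto simp: keys_update)
    ultimately show ?case
      using update.IH update.prems add single by simp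
  qed
qed

lemma monomial_ideal_subset_ideal:
  fixes J :: "'k::field mpoly set"
  assumes J: "ideal J (mpoly_ring n)" and S: "\<And>a. a \<in> S \<Longrightarrow> monom a \<in> J"
  shows "monomial_ideal S \<subseteq> J"
proof -
  interpret J: ideal J "mpoly_ring n" by (rule J)
  show ?thesis
  proof (rule monomial_ideal_subset)
    show "0 \<in> J" by (rule ideal_zero[OF J])
    show "f + g \<in> J" if "f \<in> J" "g \<in> J" for f g
      by (rule ideal_add[OF J that])
    show "Poly_Mapping.single a k \<in> J" if "a \<in> S" for a k
    proof -
      have "Poly_Mapping.single 0 k \<in> carrier (mpoly_ring n)"
        by (auto simp: exponents_def)
      from J.I_l_closed[OF S[OF that] this] show ?thesis
        by (simp add: monom_def mult_single)
    qed
  qed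
qed

text \<open>
  A term \<open>c x^(a+b)\<close> is the product of \<open>c x^a\<close> and \<open>x^b\<close>, and conversely every exponent of a product of
  two polynomials is a sum of exponents of the factors. Powers of monomial ideals are thereby
  reduced to sums of exponent sets.
\<close>

lemma ideal_prod_monomial_ideal:
  assumes "up_closed n S" "up_closed n S'"
  shows "ideal_prod (mpoly_ring n) (monomial_ideal S) (monomial_ideal S' :: 'k::field mpoly set) =
    monomial_ideal {a + b |a b. a \<in> S \<and> b \<in> S'}" (is "?P = monomial_ideal ?Q")
proof
  show "?P \<subseteq> monomial_ideal ?Q"
  proof
    fix f assume "f \<in> ?P"
    then show "f \<in> monomial_ideal ?Q"
    proof (induction rule: ideal_prod.induct)
      case (prod i j)
      then show ?case
        using keys_mult[of i j] by (fastforce simp: monomial_ideal_def)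
    next
      case (sum s1 s2)
      then show ?case
        using Poly_Mapping.keys_add[of s1 s2] by (auto simp: monomial_ideal_def)
    qed
  qed
  have single: "Poly_Mapping.single (a + b) k \<in> ?P" if "a \<in> S" "b \<in> S'" for a b k
  proof -
    have "Poly_Mapping.single a k \<in> (monomial_ideal S :: 'k mpoly set)"
      using that by (auto simp: monomial_ideal_def)
    from ideal_prod.prod[OF this, of "monom b" "monomial_ideal S'" "mpoly_ring n"] that(2)
    have "Poly_Mapping.single a k * monom b \<in> ?P" by simp
    then show ?thesis by (simp add: monom_def mult_single)
  qed
  have zero: "0 \<in> ?P"
    using ideal_prod.prod[of 0 "monomial_ideal S" 0 "monomial_ideal S'" "mpoly_ring n"]
    by (simp add: monomial_ideal_def)
  show "monomial_ideal ?Q \<subseteq> ?P"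
  proof (rule monomial_ideal_subset)
    show "0 \<in> ?P" by (rule zero)
    show "f + g \<in> ?P" if "f \<in> ?P" "g \<in> ?P" for f g
      using ideal_prod.sum[OF that] by simp
    show "Poly_Mapping.single a k \<in> ?P" if "a \<in> ?Q" for a k
      using that single by auto
  qed
qed

section \<open>Powers of squarefree Veronese ideals\<close>

definition const_exp :: "nat set \<Rightarrow> nat \<Rightarrow> exponent" where
  "const_exp A m = (\<Sum>i\<in>A. Poly_Mapping.single i m)"

lemma lookup_const_exp:
  assumes "finite A"
  shows "Poly_Mapping.lookup (const_exp A m) i = (if i \<in> A then m else 0)"
  using assms by (simp add: const_exp_def lookup_sum lookup_single when_def)

lemma const_exp_in_exponents:
  assumes "A \<subseteq> {..<n}"
  shows "const_exp A m \<in> exponents n"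
  using assms finite_subset[OF assms]
  by (auto simp: exponents_def in_keys_iff lookup_const_exp split: if_splits)

text \<open>
  The exponents of the \<open>s\<close>-th power of the ideal generated by the products of \<open>d\<close> distinct variables
  among \<open>n\<close>. A product of \<open>s\<close> generators has degree \<open>d * s\<close> and contains each variable at most \<open>s\<close>
  times, which makes the inequality necessary; \<open>veronese_Suc\<close> is the reason why it is sufficient.
\<close>

definition veronese :: "nat \<Rightarrow> nat \<Rightarrow> nat \<Rightarrow> exponent set" where
  "veronese n d s = {b \<in> exponents n. d * s \<le> (\<Sum>i<n. min (Poly_Mapping.lookup b i) s)}"

lemma up_closed_veronese: "up_closed n (veronese n d s)"
proof -
  have "(\<Sum>i<n. min (Poly_Mapping.lookup a i) s) \<le> (\<Sum>i<n. min (Poly_Mapping.lookup (a + c) i) s)" for a c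
    by (intro sum_mono) (auto simp: lookup_add)
  then show ?thesis
    unfolding up_closed_def veronese_def
    by (auto intro: exponents_add order_trans)
qed

lemma sub_sum_eq:
  fixes f :: "'a \<Rightarrow> nat"
  assumes "finite A" "t \<le> sum f A"
  obtains g where "\<And>i. g i \<le> f i" "sum g A = t"
proof -
  have "\<exists>g. (\<forall>i. g i \<le> f i) \<and> sum g A = t" using assms
  proof (induction A arbitrary: t rule: finite_induct)
    case empty
    then show ?case by auto
  next
    case (insert x A)
    have "t - min t (f x) \<le> sum f A" using insert.prems insert.hyps by auto
    from insert.IH[OF this] obtain g where g: "\<forall>i. g i \<le> f i" "sum g A = t - min t (f x)" by blast
    have "sum (g(x := min t (f x))) A = sum g A"
      using insert.hyps by (intro sum.cong) auto
    then show ?case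
      using g insert.hyps by (intro exI[of _ "g(x := min t (f x))"]) auto
  qed
  then show thesis using that by blast
qed

text \<open>
  To split a generator off \<open>b\<close>, first lower \<open>b\<close> to some \<open>c\<close> with all entries at most \<open>s + 1\<close> and sum
  exactly \<open>d * (s + 1)\<close>. Then at most \<open>d\<close> entries equal \<open>s + 1\<close> and at least \<open>d\<close> entries are positive, so
  some \<open>d\<close>-element set \<open>T\<close> contains the former and is contained in the latter. Removing the variables
  in \<open>T\<close> once leaves entries at most \<open>s\<close> with sum \<open>d * s\<close>.
\<close>

lemma veronese_Suc:
  "veronese n d (Suc s) = {a + b |a b. a \<in> veronese n d s \<and> b \<in> veronese n d 1}"
proof (intro equalityI subsetI)
  fix b assume b: "b \<in> veronese n d (Suc s)"
  then have bn: "b \<in> exponents n" by (simp add: veronese_def)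
  obtain c where c: "\<And>i. c i \<le> min (Poly_Mapping.lookup b i) (Suc s)"
    and sum_c: "(\<Sum>i<n. c i) = d * Suc s"
    using sub_sum_eq[of "{..<n}" "d * Suc s" "\<lambda>i. min (Poly_Mapping.lookup b i) (Suc s)"] b
    unfolding veronese_def by blast
  let ?full = "{i. i < n \<and> c i = Suc s}" and ?supp = "{i. i < n \<and> c i > 0}"
  have "card ?full * Suc s = (\<Sum>i\<in>?full. c i)" by simp
  also have "\<dots> \<le> (\<Sum>i<n. c i)" by (intro sum_mono2) auto
  finally have full: "card ?full \<le> d" using sum_c by (simp only: mult_le_cancel2)
  have "(\<Sum>i<n. c i) = (\<Sum>i\<in>?supp. c i)" by (intro sum.mono_neutral_right) auto
  also have "\<dots> \<le> (\<Sum>i\<in>?supp. Suc s)" using c by (intro sum_mono) auto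
  also have "\<dots> = card ?supp * Suc s" by simp
  finally have supp: "d \<le> card ?supp" using sum_c by (simp only: mult_le_cancel2)
  obtain T where T: "?full \<subseteq> T" "T \<subseteq> ?supp" "card T = d"
    using exists_subset_between[OF full supp] by fastforce
  have Tn: "T \<subseteq> {..<n}" using T by auto
  then have fT: "finite T" using finite_subset by blast
  define t where "t = const_exp T 1"
  have lt: "Poly_Mapping.lookup t i = (if i \<in> T then 1 else 0)" for i
    using fT by (simp add: t_def lookup_const_exp)
  have t1: "t \<in> veronese n d 1"
  proof -
    have "(\<Sum>i<n. min (Poly_Mapping.lookup t i) 1) = (\<Sum>i\<in>T. 1)"
      using Tn by (intro sum.mono_neutral_cong_right) (auto simp: lt)
    then show ?thesis
      using T Tn by (simp add: veronese_def t_def const_exp_in_exponents)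
  qed
  have le: "Poly_Mapping.lookup t i \<le> c i" if "i < n" for i
    using T(2) that by (auto simp: lt Suc_le_eq)
  have le': "Poly_Mapping.lookup t i \<le> Poly_Mapping.lookup b i" for i
    using T(2) c[of i] by (fastforce simp: lt)
  have eq: "b = (b - t) + t"
    using le' by (intro poly_mapping_eqI) (simp add: lookup_add lookup_minus)
  have "Poly_Mapping.keys (b - t) \<subseteq> Poly_Mapping.keys b"
    by (auto simp: in_keys_iff lookup_minus)
  then have "b - t \<in> exponents n" using bn by (auto simp: exponents_def)
  moreover have "d * s \<le> (\<Sum>i<n. min (Poly_Mapping.lookup (b - t) i) s)"
  proof -
    have "(\<Sum>i<n. c i) = (\<Sum>i<n. (c i - Poly_Mapping.lookup t i)) + (\<Sum>i<n. Poly_Mapping.lookup t i)"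
      using le by (simp add: sum.distrib[symmetric])
    moreover have "(\<Sum>i<n. Poly_Mapping.lookup t i) = (\<Sum>i\<in>T. 1)"
      using Tn by (intro sum.mono_neutral_cong_right) (auto simp: lt)
    ultimately have "d * s = (\<Sum>i<n. (c i - Poly_Mapping.lookup t i))"
      using sum_c T(3) by simp
    also have "\<dots> \<le> (\<Sum>i<n. min (Poly_Mapping.lookup (b - t) i) s)"
    proof (intro sum_mono)
      fix i assume i: "i \<in> {..<n}"
      have "c i - Poly_Mapping.lookup t i \<le> s"
        using c[of i] T(1) i by (cases "c i = Suc s") (auto simp: lt)
      then show "c i - Poly_Mapping.lookup t i \<le> min (Poly_Mapping.lookup (b - t) i) s"
        using c[of i] diff_le_mono[of "c i" "Poly_Mapping.lookup b i"] by (simp add: lookup_minus)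
    qed
    finally show ?thesis .
  qed
  ultimately have "b - t \<in> veronese n d s" by (simp add: veronese_def)
  then show "b \<in> {a + b |a b. a \<in> veronese n d s \<and> b \<in> veronese n d 1}"
    using t1 eq by blast
next
  fix x assume "x \<in> {a + b |a b. a \<in> veronese n d s \<and> b \<in> veronese n d 1}"
  then obtain a b where x: "x = a + b" and a: "a \<in> veronese n d s" and b: "b \<in> veronese n d 1"
    by blast
  have "d * Suc s \<le> (\<Sum>i<n. min (Poly_Mapping.lookup a i) s) + (\<Sum>i<n. min (Poly_Mapping.lookup b i) 1)"
    using a b by (simp add: veronese_def)
  also have "\<dots> \<le> (\<Sum>i<n. min (Poly_Mapping.lookup x i) (Suc s))"
    unfolding sum.distrib[symmetric] x by (intro sum_mono) (auto simp: lookup_add)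
  finally show "x \<in> veronese n d (Suc s)"
    using a b x by (simp add: veronese_def exponents_add)
qed

definition veronese_ideal :: "nat \<Rightarrow> nat \<Rightarrow> nat \<Rightarrow> 'k::field mpoly set" where
  "veronese_ideal n d s = monomial_ideal (veronese n d s)"

lemma ideal_veronese_ideal: "ideal (veronese_ideal n d s) (mpoly_ring n)"
  unfolding veronese_ideal_def by (intro ideal_monomial_ideal up_closed_veronese)

lemma ideal_power_veronese:
  "ideal_power (mpoly_ring n) (veronese_ideal n d 1) s = (veronese_ideal n d s :: 'k::field mpoly set)"
proof -
  interpret R: cring "mpoly_ring n :: 'k mpoly ring" by (rule cring_mpoly_ring)
  interpret M: comm_monoid "ideals_set (mpoly_ring n :: 'k mpoly ring)"
    by (rule R.ideals_set_is_comm_monoid)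
  show ?thesis
  proof (induction s)
    case 0
    have "veronese n d 0 = exponents n" by (auto simp: veronese_def)
    then show ?case
      by (simp add: ideal_power_def veronese_ideal_def monomial_ideal_def ideals_set_def mpoly_ring_def)
  next
    case (Suc s)
    have "ideal_power (mpoly_ring n) (veronese_ideal n d 1) (Suc s) =
      ideal_prod (mpoly_ring n) (veronese_ideal n d s) (veronese_ideal n d 1 :: 'k mpoly set)"
      unfolding Suc.IH[symmetric] ideal_power_def M.nat_pow_Suc by (simp add: ideals_set_def)
    also have "\<dots> = veronese_ideal n d (Suc s)"
      by (simp only: veronese_ideal_def ideal_prod_monomial_ideal[OF up_closed_veronese up_closed_veronese]
          veronese_Suc)
    finally show ?case .
  qed
qed

lemma const_exp_in_veronese_one:
  assumes "A \<subseteq> {..<n}"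
  shows "const_exp A 1 \<in> veronese n d 1 \<longleftrightarrow> d \<le> card A"
proof -
  have fA: "finite A" using assms finite_subset by blast
  have "(\<Sum>i<n. min (Poly_Mapping.lookup (const_exp A 1) i) 1) = (\<Sum>i\<in>A. 1)"
    using assms by (intro sum.mono_neutral_cong_right) (auto simp: lookup_const_exp fA)
  then show ?thesis using assms by (simp add: veronese_def const_exp_in_exponents)
qed

text \<open>
  The case \<open>s = 1\<close> says that at least \<open>d\<close> variables occur, a condition on the support alone, so the
  squarefree monomials satisfying it generate.
\<close>

lemma squarefree_veronese:
  "squarefree_monomial_ideal n (veronese_ideal n d 1 :: 'k::field mpoly set)"
proof -
  interpret R: cring "mpoly_ring n :: 'k mpoly ring" by (rule cring_mpoly_ring)
  define A where "A = {a \<in> veronese n d 1. \<forall>i. Poly_Mapping.lookup a i \<le> 1}"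
  have An: "A \<subseteq> exponents n" by (auto simp: A_def veronese_def)
  have carr: "(monom ` A :: 'k mpoly set) \<subseteq> carrier (mpoly_ring n)"
    using An by auto
  interpret J: ideal "Idl\<^bsub>mpoly_ring n\<^esub> (monom ` A :: 'k mpoly set)" "mpoly_ring n"
    by (rule R.genideal_ideal[OF carr])
  have "veronese_ideal n d 1 = Idl\<^bsub>mpoly_ring n\<^esub> (monom ` A :: 'k mpoly set)"
  proof
    show "Idl\<^bsub>mpoly_ring n\<^esub> (monom ` A :: 'k mpoly set) \<subseteq> veronese_ideal n d 1"
      by (rule R.genideal_minimal[OF ideal_veronese_ideal]) (auto simp: A_def veronese_ideal_def)
    show "veronese_ideal n d 1 \<subseteq> Idl\<^bsub>mpoly_ring n\<^esub> (monom ` A :: 'k mpoly set)"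
      unfolding veronese_ideal_def
    proof (rule monomial_ideal_subset_ideal[OF J.ideal_axioms])
      fix b assume b: "b \<in> veronese n d 1"
      define a where "a = const_exp (Poly_Mapping.keys b) 1"
      have bn: "Poly_Mapping.keys b \<subseteq> {..<n}" using b by (simp add: veronese_def exponents_def)
      have la: "Poly_Mapping.lookup a i = min (Poly_Mapping.lookup b i) 1" for i
        by (auto simp: a_def lookup_const_exp in_keys_iff)
      have "a \<in> A"
        using b bn by (simp add: A_def veronese_def la const_exp_in_exponents a_def[symmetric])
          (simp add: a_def const_exp_in_exponents)
      then have mem: "monom a \<in> Idl\<^bsub>mpoly_ring n\<^esub> (monom ` A :: 'k mpoly set)"
        using R.genideal_self[OF carr] by blast
      have "Poly_Mapping.keys (b - a) \<subseteq> Poly_Mapping.keys b"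
        by (auto simp: in_keys_iff lookup_minus)
      then have "b - a \<in> exponents n" using bn by (auto simp: exponents_def)
      then have "monom (b - a) \<in> carrier (mpoly_ring n :: 'k mpoly ring)" by simp
      from J.I_l_closed[OF mem this] have "monom (b - a + a) \<in> Idl\<^bsub>mpoly_ring n\<^esub> (monom ` A :: 'k mpoly set)"
        by (simp add: monom_mult)
      moreover have "b - a + a = b"
        by (intro poly_mapping_eqI) (simp add: lookup_add lookup_minus la)
      ultimately show "monom b \<in> Idl\<^bsub>mpoly_ring n\<^esub> (monom ` A :: 'k mpoly set)" by simp
    qed
  qed
  then show ?thesis
    unfolding squarefree_monomial_ideal_def using An by (intro exI[of _ A]) (auto simp: A_def)
qed

section \<open>Minimal primes and localization\<close>

definition weight :: "nat set \<Rightarrow> exponent \<Rightarrow> nat" where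
  "weight T a = (\<Sum>i\<in>T. Poly_Mapping.lookup a i)"

lemma weight_add: "weight T (a + b) = weight T a + weight T b"
  by (simp add: weight_def lookup_add sum.distrib)

definition var :: "nat \<Rightarrow> 'k::field mpoly" where
  "var i = monom (Poly_Mapping.single i 1)"

definition var_prime :: "nat \<Rightarrow> nat set \<Rightarrow> 'k::field mpoly set" where
  "var_prime n T = monomial_ideal {a \<in> exponents n. 0 < weight T a}"

lemma ideal_var_prime: "ideal (var_prime n T) (mpoly_ring n)"
  unfolding var_prime_def
  by (intro ideal_monomial_ideal) (auto simp: up_closed_def exponents_add weight_add)

lemma var_in_carrier: "i < n \<Longrightarrow> Poly_Mapping.keys (var i :: 'k::field mpoly) \<subseteq> exponents n"
  by (simp add: var_def exponents_def)

lemma var_in_var_prime: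
  assumes "i < n" "finite T"
  shows "var i \<in> var_prime n T \<longleftrightarrow> i \<in> T"
  using assms by (simp add: var_def var_prime_def exponents_def weight_def lookup_single when_def)

text \<open>
  Let \<open>r h\<close> be the part of \<open>h\<close> free of the variables in \<open>T\<close>. Modulo the ideal, \<open>f * g\<close> agrees with
  \<open>r f * r g\<close>, whose terms are again free of these variables. If \<open>f * g\<close> is in the ideal, then
  \<open>r f * r g\<close> must be zero, and so must one of its factors as polynomials form a domain.
\<close>

lemma primeideal_var_prime: "primeideal (var_prime n T :: 'k::field mpoly set) (mpoly_ring n)"
proof (rule primeidealI[OF ideal_var_prime cring_mpoly_ring])
  let ?R = "mpoly_ring n :: 'k mpoly ring" and ?P = "var_prime n T :: 'k mpoly set"
  interpret P: ideal ?P ?R by (rule ideal_var_prime)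
  have "(1 :: 'k mpoly) \<notin> ?P"
    by (simp add: var_prime_def monomial_ideal_def weight_def)
  moreover have "(1 :: 'k mpoly) \<in> carrier ?R" by (simp add: exponents_def)
  ultimately show "carrier ?R \<noteq> ?P" by blast
  fix f g assume f: "f \<in> carrier ?R" and g: "g \<in> carrier ?R" and fg: "f \<otimes>\<^bsub>?R\<^esub> g \<in> ?P"
  define r where "r h = Poly_Mapping.mapp (\<lambda>a v. v when weight T a = 0) h" for h :: "'k mpoly"
  have lr: "Poly_Mapping.lookup (r h) a = (Poly_Mapping.lookup h a when weight T a = 0)" for h a
    by (simp add: r_def lookup_mapp when_def in_keys_iff)
  have rP: "h - r h \<in> ?P" and rR: "r h \<in> carrier ?R" if "h \<in> carrier ?R" for h
    using that by (auto simp: var_prime_def monomial_ideal_def in_keys_iff lookup_minus lr when_def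
        split: if_splits)
  have "f * g - r f * r g = r f * (g - r g) + (f - r f) * g" by (simp add: algebra_simps)
  moreover have "r f * (g - r g) \<in> ?P"
    using P.I_l_closed[OF rP[OF g] rR[OF f]] by simp
  moreover have "(f - r f) * g \<in> ?P"
    using P.I_r_closed[OF rP[OF f] g] by simp
  ultimately have "f * g - r f * r g \<in> ?P" using ideal_add[OF ideal_var_prime] by simp
  from ideal_uminus[OF ideal_var_prime this] have "r f * r g - f * g \<in> ?P" by simp
  moreover have "f * g \<in> ?P" using fg by simp
  ultimately have "(r f * r g - f * g) + f * g \<in> ?P" by (rule ideal_add[OF ideal_var_prime])
  then have rr: "r f * r g \<in> ?P" by simp
  have "weight T a = 0" if a: "a \<in> Poly_Mapping.keys (r f * r g)" for a
  proof -
    obtain b c where "a = b + c" "b \<in> Poly_Mapping.keys (r f)" "c \<in> Poly_Mapping.keys (r g)"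
      using a keys_mult[of "r f" "r g"] by blast
    then show ?thesis by (auto simp: weight_add in_keys_iff lr)
  qed
  then have "Poly_Mapping.keys (r f * r g) = {}"
    using rr by (fastforce simp: var_prime_def monomial_ideal_def)
  then have "r f * r g = 0" by simp
  then have "r f = 0 \<or> r g = 0" by simp
  then show "f \<in> ?P \<or> g \<in> ?P"
    using rP[OF f] rP[OF g] by auto
qed

lemma var_prime_subset:
  assumes q: "ideal q (mpoly_ring n)" and T: "T \<subseteq> {..<n}" "\<And>i. i \<in> T \<Longrightarrow> var i \<in> q"
  shows "var_prime n T \<subseteq> (q :: 'k::field mpoly set)"
  unfolding var_prime_def
proof (rule monomial_ideal_subset_ideal[OF q])
  interpret q: ideal q "mpoly_ring n" by (rule q)
  fix a assume "a \<in> {a \<in> exponents n. 0 < weight T a}"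
  then have a: "a \<in> exponents n" "0 < weight T a" by auto
  have "\<exists>i\<in>T. Poly_Mapping.lookup a i > 0"
  proof (rule ccontr)
    assume "\<not> ?thesis"
    then have "weight T a = 0" unfolding weight_def by (intro sum.neutral) auto
    then show False using a(2) by simp
  qed
  then obtain i where i: "i \<in> T" "Poly_Mapping.lookup a i > 0" by blast
  let ?b = "a - Poly_Mapping.single i 1"
  have "Poly_Mapping.keys ?b \<subseteq> Poly_Mapping.keys a"
    by (auto simp: in_keys_iff lookup_minus)
  then have "monom ?b \<in> carrier (mpoly_ring n :: 'k mpoly ring)"
    using a(1) by (auto simp: exponents_def)
  from q.I_l_closed[OF T(2)[OF i(1)] this]
  have "monom (?b + Poly_Mapping.single i 1) \<in> q" by (simp add: var_def monom_mult)
  moreover have "?b + Poly_Mapping.single i 1 = a"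
    using i(2) by (intro poly_mapping_eqI) (auto simp: lookup_add lookup_minus lookup_single when_def)
  ultimately show "monom a \<in> q" by simp
qed

lemma monom_const_exp_notin_prime:
  assumes q: "primeideal q (mpoly_ring n)" and B: "B \<subseteq> {..<n}" "\<And>i. i \<in> B \<Longrightarrow> var i \<notin> q"
  shows "monom (const_exp B m) \<notin> (q :: 'k::field mpoly set)"
proof -
  let ?R = "mpoly_ring n :: 'k mpoly ring"
  interpret q: primeideal q ?R by (rule q)
  have one: "1 \<notin> q" using q.one_imp_carrier q.I_notcarr by auto
  have pow: "monom (Poly_Mapping.single i m) \<notin> q" if "i \<in> B" for i
  proof (induction m)
    case 0
    then show ?case using one by (simp add: monom_0)
  next
    case (Suc m)
    have i: "i < n" using that B by auto
    have "monom (Poly_Mapping.single i (Suc m)) = (var i * monom (Poly_Mapping.single i m) :: 'k mpoly)"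
      by (simp add: var_def monom_mult single_add[symmetric])
    moreover have "monom (Poly_Mapping.single i m) \<in> carrier ?R"
      using i by (auto simp: exponents_def)
    ultimately show ?case
      using q.I_prime[of "var i" "monom (Poly_Mapping.single i m)"] B(2)[OF that] Suc.IH
        var_in_carrier[OF i] by auto
  qed
  have "finite B" using B(1) finite_subset by blast
  then show ?thesis using B(1) pow
  proof (induction B rule: finite_induct)
    case empty
    then show ?case using one by (simp add: const_exp_def monom_0)
  next
    case (insert i B)
    have "monom (const_exp (insert i B) m) =
        monom (Poly_Mapping.single i m) * (monom (const_exp B m) :: 'k mpoly)"
      using insert.hyps by (simp add: const_exp_def monom_mult)
    moreover have "monom (Poly_Mapping.single i m) \<in> carrier ?R"
      using insert.prems by (auto simp: exponents_def)
    moreover have "monom (const_exp B m) \<in> carrier ?R"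
      using insert.prems by (simp add: const_exp_in_exponents)
    ultimately show ?case
      using q.I_prime[of "monom (Poly_Mapping.single i m)" "monom (const_exp B m)"] insert by auto
  qed
qed

text \<open>
  Outside \<open>T\<close> there are only \<open>d - 1\<close> indices, which contribute at most \<open>(d - 1) * s\<close> to the truncated
  sum, so the indices in \<open>T\<close> contribute the remaining \<open>s\<close>.
\<close>

lemma veronese_weight:
  assumes b: "b \<in> veronese n d s" and T: "T \<subseteq> {..<n}" "card T + d = Suc n" and "T \<noteq> {}"
  shows "s \<le> weight T b"
proof -
  have fT: "finite T" using T(1) finite_subset by blast
  have "d * s \<le> (\<Sum>i<n. min (Poly_Mapping.lookup b i) s)" using b by (simp add: veronese_def)
  also have "\<dots> = (\<Sum>i\<in>T. min (Poly_Mapping.lookup b i) s) + (\<Sum>i\<in>{..<n} - T. min (Poly_Mapping.lookup b i) s)"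
    using T(1) sum.subset_diff[of T "{..<n}"] by (simp add: add.commute)
  also have "\<dots> \<le> weight T b + (\<Sum>i\<in>{..<n} - T. s)"
    unfolding weight_def by (intro add_mono sum_mono) auto
  also have "(\<Sum>i\<in>{..<n} - T. s) = (d - 1) * s"
  proof -
    have "n - card T = d - 1" using T(2) by simp
    then show ?thesis using T fT by (simp add: card_Diff_subset)
  qed
  finally have *: "d * s \<le> weight T b + (d - 1) * s" .
  have "card T \<le> n" using card_mono[OF _ T(1)] by simp
  then obtain e where "d = Suc e" using T(2) by (cases d) auto
  then show ?thesis using * by simp
qed

text \<open>
  The product of all variables outside \<open>q\<close> is not in \<open>q\<close>, hence not in the Veronese ideal, so there
  are fewer than \<open>d\<close> of them.
\<close>

lemma card_vars_in_prime:
  assumes q: "primeideal q (mpoly_ring n)" and V: "veronese_ideal n d 1 \<subseteq> (q :: 'k::field mpoly set)"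
  shows "n < card {i. i < n \<and> var i \<in> q} + d"
proof -
  let ?A = "{i. i < n \<and> var i \<in> q}" and ?B = "{i. i < n \<and> var i \<notin> q}"
  have B: "?B \<subseteq> {..<n}" by auto
  have "monom (const_exp ?B 1) \<notin> q"
    by (rule monom_const_exp_notin_prime[OF q]) auto
  then have "const_exp ?B 1 \<notin> veronese n d 1"
    using V monom_in_monomial_ideal unfolding veronese_ideal_def by blast
  then have "card ?B < d"
    using const_exp_in_veronese_one[OF B, of d] by simp
  moreover have "card ?A + card ?B = card (?A \<union> ?B)"
    by (intro card_Un_disjoint[symmetric]) auto
  moreover have "?A \<union> ?B = {..<n}" by auto
  ultimately show ?thesis by simp
qed

text \<open>
  A prime over the ideal contains at least \<open>n - d + 1\<close> variables (\<open>card_vars_in_prime\<close>), and any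
  \<open>n - d + 1\<close> variables generate a prime over the ideal.
\<close>

lemma minimal_primes_veronese:
  assumes "0 < d" "d \<le> n"
  shows "minimal_primes (mpoly_ring n) (veronese_ideal n d 1 :: 'k::field mpoly set) =
    {var_prime n T |T. T \<subseteq> {..<n} \<and> card T + d = Suc n}"
proof (intro equalityI subsetI)
  let ?V = "veronese_ideal n d 1 :: 'k mpoly set"
  have sub: "?V \<subseteq> var_prime n T" if "T \<subseteq> {..<n}" "card T + d = Suc n" for T
  proof -
    have nonempty: "T \<noteq> {}" using that assms by auto
    have "veronese n d 1 \<subseteq> {a \<in> exponents n. 0 < weight T a}"
    proof
      fix a assume a: "a \<in> veronese n d 1"
      have "1 \<le> weight T a" by (rule veronese_weight[OF a that nonempty])
      then show "a \<in> {a \<in> exponents n. 0 < weight T a}"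
        using a by (simp add: veronese_def)
    qed
    then show ?thesis
      unfolding veronese_ideal_def var_prime_def monomial_ideal_def by blast
  qed
  {
    fix p assume p: "p \<in> minimal_primes (mpoly_ring n) ?V"
    then have pp: "primeideal p (mpoly_ring n)" and Vp: "?V \<subseteq> p"
      and minp: "\<And>q. primeideal q (mpoly_ring n) \<Longrightarrow> ?V \<subseteq> q \<Longrightarrow> q \<subseteq> p \<Longrightarrow> q = p"
      unfolding minimal_primes_def by blast+
    have "Suc n - d \<le> card {i. i < n \<and> var i \<in> p}"
      using card_vars_in_prime[OF pp Vp] by simp
    then obtain T where T: "T \<subseteq> {i. i < n \<and> var i \<in> p}" "card T = Suc n - d"
      by (rule obtain_subset_with_card_n)
    then have Tn: "T \<subseteq> {..<n}" "card T + d = Suc n" using assms by auto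
    have "var_prime n T \<subseteq> p"
      using T Tn by (intro var_prime_subset primeideal.axioms(1)[OF pp]) auto
    then have "var_prime n T = p"
      by (rule minp[OF primeideal_var_prime sub[OF Tn]])
    with Tn show "p \<in> {var_prime n T |T. T \<subseteq> {..<n} \<and> card T + d = Suc n}" by blast
  }
  fix p :: "'k mpoly set"
  assume "p \<in> {var_prime n T |T. T \<subseteq> {..<n} \<and> card T + d = Suc n}"
  then obtain T where p: "p = var_prime n T" and T: "T \<subseteq> {..<n}" "card T + d = Suc n" by blast
  have fT: "finite T" using T(1) finite_subset by blast
  have "q = p" if q: "primeideal q (mpoly_ring n)" "?V \<subseteq> q" "q \<subseteq> p" for q
  proof -
    have "{i. i < n \<and> var i \<in> q} \<subseteq> T"
      using q(3) var_in_var_prime[OF _ fT, where ?'a = 'k] by (auto simp: p)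
    moreover have "card T \<le> card {i. i < n \<and> var i \<in> q}"
      using card_vars_in_prime[OF q(1,2)] T(2) by simp
    ultimately have "{i. i < n \<and> var i \<in> q} = T"
      by (rule card_seteq[OF fT])
    then have "p \<subseteq> q"
      unfolding p by (intro var_prime_subset primeideal.axioms(1)[OF q(1)] T) auto
    then show ?thesis using q(3) by blast
  qed
  then show "p \<in> minimal_primes (mpoly_ring n) ?V"
    unfolding minimal_primes_def using primeideal_var_prime[of n T] sub[OF T] p by blast
qed

text \<open>
  The extension of \<open>J\<close> to the localization consists of the fractions with numerator in \<open>J\<close>; clearing
  denominators turns membership into a condition in the polynomial ring.
\<close>

lemma Fract_in_localized_ideal_iff:
  fixes p J :: "'k::field mpoly set"
  assumes p: "primeideal p (mpoly_ring n)" and J: "ideal J (mpoly_ring n)"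
    and f: "f \<in> carrier (mpoly_ring n)"
  shows "Fract f 1 \<in> localized_ideal n p J \<longleftrightarrow> (\<exists>u \<in> carrier (mpoly_ring n) - p. u * f \<in> J)"
proof -
  let ?R = "mpoly_ring n :: 'k mpoly ring" and ?L = "localization n p"
  interpret p: primeideal p ?R by (rule p)
  interpret J: ideal J ?R by (rule J)
  interpret L: cring ?L by (rule cring_localization[OF p])
  have L: "x \<otimes>\<^bsub>?L\<^esub> y = x * y" "x \<oplus>\<^bsub>?L\<^esub> y = x + y" "\<one>\<^bsub>?L\<^esub> = 1" "\<zero>\<^bsub>?L\<^esub> = 0" for x y
    by (simp_all add: localization_def)
  define D where "D = carrier ?R - p"
  have carr: "x \<in> carrier ?L \<longleftrightarrow> (\<exists>a b. x = Fract a b \<and> a \<in> carrier ?R \<and> b \<in> D)" for x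
    by (auto simp: localization_def D_def)
  have D0: "b \<noteq> 0" if "b \<in> D" for b
    using that ideal_zero[OF p.is_ideal] by (auto simp: D_def)
  have one: "1 \<in> carrier ?R" by (simp add: exponents_def)
  have D1: "1 \<in> D"
    using p.one_imp_carrier p.I_notcarr one by (auto simp: D_def)
  have Dmult: "b * d \<in> D" if "b \<in> D" "d \<in> D" for b d
    using that p.I_prime[of b d] p.m_closed[of b d] by (auto simp: D_def)
  have DR: "b \<in> carrier ?R" if "b \<in> D" for b
    using that by (simp add: D_def)
  have sub: "(\<lambda>g. Fract g 1) ` J \<subseteq> carrier ?L"
  proof
    fix x assume "x \<in> (\<lambda>g. Fract g 1) ` J"
    then obtain g where g: "x = Fract g 1" "g \<in> J" by blast
    from g(1) J.Icarr[OF g(2)] D1 show "x \<in> carrier ?L" unfolding carr by blast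
  qed
  show ?thesis
  proof
    assume "\<exists>u \<in> carrier ?R - p. u * f \<in> J"
    then obtain u where u: "u \<in> D" "u * f \<in> J" by (auto simp: D_def)
    interpret K: ideal "localized_ideal n p J" ?L
      unfolding localized_ideal_def by (rule L.genideal_ideal[OF sub])
    have "Fract (u * f) 1 \<in> localized_ideal n p J"
      using L.genideal_self[OF sub] u(2) unfolding localized_ideal_def by blast
    moreover have "Fract 1 u \<in> carrier ?L" using one u(1) unfolding carr by blast
    ultimately have "Fract (u * f) 1 * Fract 1 u \<in> localized_ideal n p J"
      using K.I_r_closed by (simp only: L)
    moreover have "Fract (u * f) 1 * Fract 1 u = Fract f 1"
      using D0[OF u(1)] by (simp add: eq_fract)
    ultimately show "Fract f 1 \<in> localized_ideal n p J" by simp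
  next
    assume f_loc: "Fract f 1 \<in> localized_ideal n p J"
    define K where "K = {Fract a b |a b. a \<in> J \<and> b \<in> D}"
    have "ideal K ?L"
    proof (rule idealI)
      show "ring ?L" by (rule L.ring_axioms)
      show "subgroup K (add_monoid ?L)"
      proof (rule L.add.subgroupI)
        show "K \<subseteq> carrier ?L"
        proof
          fix x assume "x \<in> K"
          then obtain a b where ab: "x = Fract a b" "a \<in> J" "b \<in> D" by (auto simp: K_def)
          from ab(1) J.Icarr[OF ab(2)] ab(3) show "x \<in> carrier ?L" unfolding carr by blast
        qed
        show "K \<noteq> {}" using ideal_zero[OF J] D1 unfolding K_def by blast
      next
        fix x assume x: "x \<in> K"
        then obtain a b where ab: "x = Fract a b" "a \<in> J" "b \<in> D" by (auto simp: K_def)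
        have a: "- a \<in> J" by (rule ideal_uminus[OF J ab(2)])
        have mx: "- x \<in> K" using a ab by (auto simp: K_def)
        have "x \<in> carrier ?L" using ab(1) J.Icarr[OF ab(2)] ab(3) unfolding carr by blast
        moreover have "- x = Fract (- a) b" using ab(1) by simp
        then have "- x \<in> carrier ?L" using J.Icarr[OF a] ab(3) unfolding carr by blast
        ultimately have "\<ominus>\<^bsub>?L\<^esub> x = - x"
          by (intro L.minus_equality) (simp_all add: L)
        then show "\<ominus>\<^bsub>?L\<^esub> x \<in> K" using mx by simp
      next
        fix x y assume "x \<in> K" "y \<in> K"
        then obtain a b c d where *: "x = Fract a b" "a \<in> J" "b \<in> D" "y = Fract c d" "c \<in> J" "d \<in> D"
          by (auto simp: K_def)
        have "x + y = Fract (a * d + c * b) (b * d)" using * by (simp add: D0)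
        moreover have "a * d + c * b \<in> J"
          using ideal_add[OF J J.I_r_closed[OF *(2) DR[OF *(6)]] J.I_r_closed[OF *(5) DR[OF *(3)]]]
          by simp
        ultimately show "x \<oplus>\<^bsub>?L\<^esub> y \<in> K" using Dmult[OF *(3,6)] unfolding K_def L by blast
      qed
    next
      have *: "y * x \<in> K" if x: "x \<in> K" and y: "y \<in> carrier ?L" for x y
      proof -
        obtain a b where ab: "x = Fract a b" "a \<in> J" "b \<in> D" using x by (auto simp: K_def)
        obtain c d where cd: "y = Fract c d" "c \<in> carrier ?R" "d \<in> D" using y unfolding carr by blast
        have "y * x = Fract (c * a) (d * b)" using ab cd by simp
        moreover have "c * a \<in> J" using J.I_l_closed[OF ab(2) cd(2)] by simp
        ultimately show ?thesis using Dmult[OF cd(3) ab(3)] unfolding K_def by blast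
      qed
      show "y \<otimes>\<^bsub>?L\<^esub> x \<in> K" if "x \<in> K" "y \<in> carrier ?L" for x y
        using *[OF that] by (simp add: L)
      show "x \<otimes>\<^bsub>?L\<^esub> y \<in> K" if "x \<in> K" "y \<in> carrier ?L" for x y
        using *[OF that] by (simp add: L mult.commute)
    qed
    moreover have "(\<lambda>g. Fract g 1) ` J \<subseteq> K" using D1 by (auto simp: K_def)
    ultimately have "localized_ideal n p J \<subseteq> K"
      unfolding localized_ideal_def by (rule L.genideal_minimal)
    then obtain a b where ab: "Fract f 1 = Fract a b" "a \<in> J" "b \<in> D"
      using f_loc by (auto simp: K_def)
    then have "b * f = a" using D0[OF ab(3)] by (simp add: eq_fract mult.commute)
    then show "\<exists>u \<in> carrier ?R - p. u * f \<in> J" using ab by (auto simp: D_def)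
  qed
qed

text \<open>
  Let \<open>T\<close> generate a minimal prime. A polynomial \<open>u\<close> outside this prime has a term free of \<open>T\<close>, and the
  corresponding term of \<open>u x^b\<close> has the same \<open>T\<close>-weight as \<open>x^b\<close>; so \<open>u x^b \<in> I^s\<close> forces weight at least
  \<open>s\<close>. Conversely, the product of the variables outside \<open>T\<close>, each to the power \<open>s\<close>, serves as \<open>u\<close>: it
  contributes \<open>(d - 1) * s\<close> to the truncated sum that decides membership in \<open>I^s\<close>.
\<close>

lemma monom_in_symbolic_power_veronese:
  assumes d: "0 < d" "d \<le> n" and b: "b \<in> exponents n"
  shows "monom b \<in> (symbolic_power n (veronese_ideal n d 1) s :: 'k::field mpoly set) \<longleftrightarrow>
    (\<forall>T \<subseteq> {..<n}. card T + d = Suc n \<longrightarrow> s \<le> weight T b)"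
proof -
  let ?R = "mpoly_ring n :: 'k mpoly ring" and ?J = "veronese_ideal n d s :: 'k mpoly set"
  have "(\<exists>u \<in> carrier ?R - var_prime n T. u * monom b \<in> ?J) \<longleftrightarrow> s \<le> weight T b"
    if T: "T \<subseteq> {..<n}" "card T + d = Suc n" for T
  proof
    assume "\<exists>u \<in> carrier ?R - var_prime n T. u * monom b \<in> ?J"
    then obtain u where u: "u \<in> carrier ?R" "u \<notin> var_prime n T" "u * monom b \<in> ?J" by blast
    then obtain c where c: "c \<in> Poly_Mapping.keys u" "weight T c = 0"
      by (auto simp: var_prime_def monomial_ideal_def)
    have "b + c \<in> Poly_Mapping.keys (monom b * u)"
      using c(1) by (simp add: in_keys_iff lookup_add_monom_mult)
    then have "b + c \<in> veronese n d s"
      using u(3) by (auto simp: veronese_ideal_def monomial_ideal_def mult.commute)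
    moreover have "T \<noteq> {}" using T d by auto
    ultimately have "s \<le> weight T (b + c)" using veronese_weight T by blast
    then show "s \<le> weight T b" using c(2) by (simp add: weight_add)
  next
    assume s: "s \<le> weight T b"
    let ?B = "{..<n} - T"
    let ?u = "monom (const_exp ?B s) :: 'k mpoly"
    have fT: "finite T" using T(1) finite_subset by blast
    have "?u \<notin> var_prime n T"
      by (rule monom_const_exp_notin_prime[OF primeideal_var_prime]) (auto simp: var_in_var_prime fT)
    moreover have "?u \<in> carrier ?R" by (simp add: const_exp_in_exponents)
    moreover have "?u * monom b \<in> ?J"
    proof -
      have "s \<le> (\<Sum>i\<in>T. min (Poly_Mapping.lookup b i) s)"
      proof (cases "\<exists>i\<in>T. s \<le> Poly_Mapping.lookup b i")
        case True
        then obtain i where i: "i \<in> T" "s \<le> Poly_Mapping.lookup b i" by blast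
        then have "s = min (Poly_Mapping.lookup b i) s" by simp
        also have "\<dots> \<le> (\<Sum>i\<in>T. min (Poly_Mapping.lookup b i) s)"
          using i fT by (intro member_le_sum) auto
        finally show ?thesis .
      next
        case False
        then have "(\<Sum>i\<in>T. min (Poly_Mapping.lookup b i) s) = weight T b"
          unfolding weight_def by (intro sum.cong) auto
        then show ?thesis using s by simp
      qed
      moreover have "(d - 1) * s = (\<Sum>i\<in>?B. s)"
      proof -
        have "n - card T = d - 1" using T(2) by simp
        then show ?thesis using T fT by (simp add: card_Diff_subset)
      qed
      ultimately have "s + (d - 1) * s \<le>
          (\<Sum>i\<in>T. min (Poly_Mapping.lookup b i) s) + (\<Sum>i\<in>?B. s)" by linarith
      also have "\<dots> \<le> (\<Sum>i\<in>T. min (Poly_Mapping.lookup (const_exp ?B s + b) i) s) +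
          (\<Sum>i\<in>?B. min (Poly_Mapping.lookup (const_exp ?B s + b) i) s)"
        by (intro add_mono sum_mono) (auto simp: lookup_add lookup_const_exp)
      also have "\<dots> = (\<Sum>i<n. min (Poly_Mapping.lookup (const_exp ?B s + b) i) s)"
        using sum.subset_diff[OF T(1) finite_lessThan,
            of "\<lambda>i. min (Poly_Mapping.lookup (const_exp ?B s + b) i) s"] by linarith
      finally have "d * s \<le> \<dots>"
        using d by (cases d) auto
      then show ?thesis
        using b by (simp add: monom_mult veronese_ideal_def veronese_def exponents_add const_exp_in_exponents)
    qed
    ultimately show "\<exists>u \<in> carrier ?R - var_prime n T. u * monom b \<in> ?J" by blast
  qed
  note local = this
  have mb: "monom b \<in> carrier ?R" using b by simp
  have "monom b \<in> symbolic_power n (veronese_ideal n d 1 :: 'k mpoly set) s \<longleftrightarrow>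
      (\<forall>p \<in> {var_prime n T |T. T \<subseteq> {..<n} \<and> card T + d = Suc n}.
        Fract (monom b) 1 \<in> localized_ideal n p ?J)"
    using mb unfolding symbolic_power_def minimal_primes_veronese[OF d] ideal_power_veronese
    by (simp only: mem_Collect_eq simp_thms)
  also have "\<dots> \<longleftrightarrow> (\<forall>T \<subseteq> {..<n}. card T + d = Suc n \<longrightarrow>
      Fract (monom b) 1 \<in> localized_ideal n (var_prime n T) ?J)" by blast
  also have "\<dots> \<longleftrightarrow> (\<forall>T \<subseteq> {..<n}. card T + d = Suc n \<longrightarrow> s \<le> weight T b)"
    unfolding Fract_in_localized_ideal_iff[OF primeideal_var_prime ideal_veronese_ideal mb]
    using local by (simp cong: imp_cong)
  finally show ?thesis .
qed

section \<open>Radicals of colon ideals\<close>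

lemma monom_pow: "(monom (const_exp F 1) :: 'k::field mpoly) ^ m = monom (const_exp F m)"
proof (induction m)
  case 0
  then show ?case by (simp add: const_exp_def monom_0)
next
  case (Suc m)
  have "const_exp F (Suc m) = const_exp F 1 + const_exp F m"
    by (simp add: const_exp_def sum.distrib[symmetric] single_add[symmetric])
  then show ?case using Suc by (simp add: monom_mult)
qed

lemma squarefree_in_radical_colon:
  assumes "F \<subseteq> {..<n}"
  shows "monom (const_exp F 1) \<in> radical (mpoly_ring n) (colon (mpoly_ring n) J (monom a)) \<longleftrightarrow>
    (\<exists>m. monom (const_exp F m + a) \<in> (J :: 'k::field mpoly set))"
  using assms
  by (simp add: radical_def colon_def monom_pow monom_mult const_exp_in_exponents del: One_nat_def)

text \<open>
  Multiplying \<open>x^a\<close> by a power of \<open>x_F\<close> makes the weight on every \<open>T\<close> meeting \<open>F\<close> as large as required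
  and leaves the weight on the other \<open>T\<close> unchanged.
\<close>

lemma in_radical_colon_symbolic_power:
  assumes d: "0 < d" "d \<le> n" and a: "a \<in> exponents n" and F: "F \<subseteq> {..<n}"
  shows "monom (const_exp F 1) \<in> radical (mpoly_ring n)
      (colon (mpoly_ring n) (symbolic_power n (veronese_ideal n d 1 :: 'k::field mpoly set) s) (monom a)) \<longleftrightarrow>
    (\<forall>T \<subseteq> {..<n}. card T + d = Suc n \<longrightarrow> T \<inter> F = {} \<longrightarrow> s \<le> weight T a)"
proof -
  have fF: "finite F" using F finite_subset by blast
  have ex: "const_exp F m + a \<in> exponents n" for m
    using F a by (simp add: exponents_add const_exp_in_exponents)
  have dis: "weight T (const_exp F m + a) = weight T a" if "T \<inter> F = {}" for T m
    using that unfolding weight_def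
    by (intro sum.cong) (auto simp: lookup_add lookup_const_exp fF)
  have meet: "s \<le> weight T (const_exp F s + a)" if T: "T \<inter> F \<noteq> {}" "T \<subseteq> {..<n}" for T
  proof -
    obtain i where i: "i \<in> T" "i \<in> F" using T by blast
    have "finite T" using T finite_subset by blast
    then have "Poly_Mapping.lookup (const_exp F s + a) i \<le> weight T (const_exp F s + a)"
      unfolding weight_def using i by (intro member_le_sum) auto
    then show ?thesis using i by (simp add: lookup_add lookup_const_exp fF)
  qed
  show ?thesis
    unfolding squarefree_in_radical_colon[OF F] monom_in_symbolic_power_veronese[OF d ex]
    using dis meet by metis
qed

text \<open>
  Multiplying \<open>x^a\<close> by a high power of \<open>x_F\<close> raises the truncated exponents at the indices in \<open>F\<close> to
  their maximum \<open>s\<close>.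
\<close>

lemma in_radical_colon_power:
  assumes a: "a \<in> exponents n" and F: "F \<subseteq> {..<n}"
  shows "monom (const_exp F 1) \<in> radical (mpoly_ring n)
      (colon (mpoly_ring n) (ideal_power (mpoly_ring n) (veronese_ideal n d 1 :: 'k::field mpoly set) s) (monom a)) \<longleftrightarrow>
    d * s \<le> (\<Sum>i<n. if i \<in> F then s else min (Poly_Mapping.lookup a i) s)"
proof -
  have fF: "finite F" using F finite_subset by blast
  have ex: "const_exp F m + a \<in> exponents n" for m
    using F a by (simp add: exponents_add const_exp_in_exponents)
  let ?S = "\<lambda>m. \<Sum>i<n. min (Poly_Mapping.lookup (const_exp F m + a) i) s"
  let ?B = "\<Sum>i<n. if i \<in> F then s else min (Poly_Mapping.lookup a i) s"
  have le: "?S m \<le> ?B" for m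
    by (intro sum_mono) (simp add: lookup_add lookup_const_exp fF)
  have eq: "?S s = ?B"
    by (intro sum.cong) (simp_all add: lookup_add lookup_const_exp fF)
  have "(\<exists>m. d * s \<le> ?S m) \<longleftrightarrow> d * s \<le> ?B"
  proof
    assume "\<exists>m. d * s \<le> ?S m"
    then obtain m where "d * s \<le> ?S m" by blast
    then show "d * s \<le> ?B" using le[of m] by (rule order_trans)
  next
    assume "d * s \<le> ?B"
    then have "d * s \<le> ?S s" by (simp only: eq)
    then show "\<exists>m. d * s \<le> ?S m" by blast
  qed
  then show ?thesis
    unfolding squarefree_in_radical_colon[OF F] ideal_power_veronese
    using ex by (simp add: veronese_ideal_def veronese_def)
qed

section \<open>The counterexample\<close>

lemma assrad_subsetD:
  assumes "assrad n I \<subseteq> assrad n (J :: 'k::field mpoly set)" "a \<in> exponents n" "monom a \<notin> I"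
  obtains b where "b \<in> exponents n"
    "radical (mpoly_ring n) (colon (mpoly_ring n) I (monom a)) =
     radical (mpoly_ring n) (colon (mpoly_ring n) J (monom b))"
  using assms unfolding assrad_def by blast

lemma weight_three: "i \<noteq> j \<Longrightarrow> i \<noteq> k \<Longrightarrow> j \<noteq> k \<Longrightarrow>
  weight {i, j, k} a = Poly_Mapping.lookup a i + Poly_Mapping.lookup a j + Poly_Mapping.lookup a k"
  by (simp add: weight_def)

lemma sum_lessThan_5: "(\<Sum>i<5. f i) = f 0 + f 1 + f 2 + f 3 + (f 4 :: nat)" for f :: "nat \<Rightarrow> nat"
  by (simp add: eval_nat_numeral)

text \<open>
  Taking for \<open>F\<close> the complement of a three-element set \<open>T\<close> tests the weight on \<open>T\<close> alone. Hence \<open>a\<close> and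
  \<open>b\<close> give the same radical only if \<open>T\<close> has \<open>a\<close>-weight at least \<open>3\<close> exactly when it has \<open>b\<close>-weight at
  least \<open>4\<close>. The \<open>a\<close>-weight is \<open>2\<close> if \<open>0 \<in> T\<close> and \<open>3\<close> otherwise.
\<close>

lemma symbolic_not_increasing:
  "\<not> assrad 5 (symbolic_power 5 (veronese_ideal 5 3 1) 3 :: 'k::field mpoly set) \<subseteq>
     assrad 5 (symbolic_power 5 (veronese_ideal 5 3 1) 4)"
proof
  assume sub: "assrad 5 (symbolic_power 5 (veronese_ideal 5 3 1) 3 :: 'k mpoly set) \<subseteq>
     assrad 5 (symbolic_power 5 (veronese_ideal 5 3 1) 4)"
  define a where "a = const_exp {1, 2, 3, 4} 1"
  have a: "a \<in> exponents 5" unfolding a_def by (rule const_exp_in_exponents) auto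
  have la: "Poly_Mapping.lookup a i = (if i \<in> {1, 2, 3, 4} then 1 else 0)" for i
    by (simp add: a_def lookup_const_exp)
  have "\<not> 3 \<le> weight {0, 1, 2} a" by (simp add: weight_three la)
  then have "monom a \<notin> (symbolic_power 5 (veronese_ideal 5 3 1) 3 :: 'k mpoly set)"
    using monom_in_symbolic_power_veronese[of 3 5 a 3, where ?'k = 'k] a
    by (auto dest!: spec[of _ "{0, 1, 2}"])
  from assrad_subsetD[OF sub a this] obtain b where b: "b \<in> exponents 5"
    and eq: "radical (mpoly_ring 5) (colon (mpoly_ring 5) (symbolic_power 5 (veronese_ideal 5 3 1) 3) (monom a)) =
     radical (mpoly_ring 5) (colon (mpoly_ring 5) (symbolic_power 5 (veronese_ideal 5 3 1) 4 :: 'k mpoly set) (monom b))"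
    by blast
  have key: "3 \<le> weight T a \<longleftrightarrow> 4 \<le> weight T b" if T: "T \<subseteq> {..<5}" "card T = 3" for T
  proof -
    let ?F = "{..<5} - T"
    \<comment> \<open>\<open>T\<close> is the only three-element set disjoint from its complement.\<close>
    have only: "U = T" if "U \<subseteq> {..<5}" "card U + 3 = Suc 5" "U \<inter> ?F = {}" for U
      using that T finite_subset[OF T(1)] by (intro card_subset_eq) auto
    have "(\<forall>U \<subseteq> {..<5}. card U + 3 = Suc 5 \<longrightarrow> U \<inter> ?F = {} \<longrightarrow> s \<le> weight U c) \<longleftrightarrow> s \<le> weight T c" for s c
      using only T by auto
    then show ?thesis
      using in_radical_colon_symbolic_power[of 3 5 a ?F 3, where ?'k = 'k]
        in_radical_colon_symbolic_power[of 3 5 b ?F 4, where ?'k = 'k] a b eq by simp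
  qed
  have k: "3 \<le> Poly_Mapping.lookup a i + Poly_Mapping.lookup a j + Poly_Mapping.lookup a k \<longleftrightarrow>
    4 \<le> Poly_Mapping.lookup b i + Poly_Mapping.lookup b j + Poly_Mapping.lookup b k"
    if "i \<noteq> j" "i \<noteq> k" "j \<noteq> k" "i < 5" "j < 5" "k < 5" for i j k
    using key[of "{i, j, k}"] that by (simp add: weight_three)
  let ?b = "Poly_Mapping.lookup b"
  have pair: "?b i + ?b j \<le> 3" if "i \<noteq> j" "i \<in> {1, 2, 3, 4}" "j \<in> {1, 2, 3, 4}" for i j
  proof -
    have "\<not> 4 \<le> ?b 0 + ?b i + ?b j"
      using k[of 0 i j] that by (auto simp: la)
    then show ?thesis by linarith
  qed
  have triple: "4 \<le> ?b i + ?b j + ?b k"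
    if "i \<noteq> j" "i \<noteq> k" "j \<noteq> k" "i \<in> {1, 2, 3, 4}" "j \<in> {1, 2, 3, 4}" "k \<in> {1, 2, 3, 4}" for i j k
    using k[of i j k] that by (auto simp: la)
  \<comment> \<open>If \<open>b 1 \<le> 1\<close>, any two of the other three entries have sum exactly \<open>3\<close>; if \<open>b 1 \<ge> 2\<close>, the
    other three are at most \<open>1\<close> and cannot have sum \<open>4\<close>.\<close>
  show False
  proof (cases "?b 1 \<le> 1")
    case True
    have "?b 2 + ?b 3 = 3" "?b 2 + ?b 4 = 3" "?b 3 + ?b 4 = 3"
      using True pair[of 2 3] pair[of 2 4] pair[of 3 4]
        triple[of 1 2 3] triple[of 1 2 4] triple[of 1 3 4] by simp_all
    then show False by presburger
  next
    case False
    have "?b 2 \<le> 1" "?b 3 \<le> 1" "?b 4 \<le> 1"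
      using False pair[of 1 2] pair[of 1 3] pair[of 1 4] by simp_all
    then show False using triple[of 2 3 4] by simp
  qed
qed

text \<open>
  The radical given by \<open>a\<close> contains \<open>x_0\<close> and the products of two of the other variables, but none of
  these other variables itself. With \<open>c i = min (b i) 3\<close>, the first condition gives
  \<open>c 1 + \<dots> + c 4 \<ge> 6\<close> and the last one \<open>c 0 + \<dots> + c 4 - c i \<le> 5\<close> for each \<open>i \<in> {1, 2, 3, 4}\<close>. Adding up the
  latter over \<open>i\<close> yields \<open>4 * c 0 + 3 * (c 1 + \<dots> + c 4) \<le> 20\<close>, so \<open>c 0 = 0\<close> and \<open>c 1 + \<dots> + c 4 = 6\<close>. The
  products of two variables give sums of pairs at least \<open>3\<close>, thus equal to \<open>3\<close>.
\<close>

lemma power_not_increasing: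
  "\<not> assrad 5 (ideal_power (mpoly_ring 5) (veronese_ideal 5 3 1) 2 :: 'k::field mpoly set) \<subseteq>
     assrad 5 (ideal_power (mpoly_ring 5) (veronese_ideal 5 3 1) 3)"
proof
  assume sub: "assrad 5 (ideal_power (mpoly_ring 5) (veronese_ideal 5 3 1) 2 :: 'k mpoly set) \<subseteq>
     assrad 5 (ideal_power (mpoly_ring 5) (veronese_ideal 5 3 1) 3)"
  define a where "a = const_exp {1, 2, 3, 4} 1"
  have a: "a \<in> exponents 5" unfolding a_def by (rule const_exp_in_exponents) auto
  have la: "Poly_Mapping.lookup a i = (if i \<in> {1, 2, 3, 4} then 1 else 0)" for i
    by (simp add: a_def lookup_const_exp)
  have "monom a \<notin> (ideal_power (mpoly_ring 5) (veronese_ideal 5 3 1) 2 :: 'k mpoly set)"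
    unfolding ideal_power_veronese
    by (simp add: veronese_ideal_def veronese_def sum_lessThan_5 la)
  from assrad_subsetD[OF sub a this] obtain b where b: "b \<in> exponents 5"
    and eq: "radical (mpoly_ring 5) (colon (mpoly_ring 5) (ideal_power (mpoly_ring 5) (veronese_ideal 5 3 1) 2) (monom a)) =
     radical (mpoly_ring 5) (colon (mpoly_ring 5) (ideal_power (mpoly_ring 5) (veronese_ideal 5 3 1) 3 :: 'k mpoly set) (monom b))"
    by blast
  have key: "6 \<le> (\<Sum>i<5. if i \<in> F then 2 else min (Poly_Mapping.lookup a i) 2) \<longleftrightarrow>
      9 \<le> (\<Sum>i<5. if i \<in> F then 3 else min (Poly_Mapping.lookup b i) 3)" if F: "F \<subseteq> {..<5}" for F
    using in_radical_colon_power[OF a F, of 3 2, where ?'k = 'k]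
      in_radical_colon_power[OF b F, of 3 3, where ?'k = 'k] eq by simp
  define c where "c i = min (Poly_Mapping.lookup b i) 3" for i
  note key' = key[unfolded sum_lessThan_5 la, folded c_def]
  have all: "6 \<le> c 1 + c 2 + c 3 + c 4"
    using key'[of "{0}"] by simp
  have one: "c 0 + c 2 + c 3 + c 4 \<le> 5" "c 0 + c 1 + c 3 + c 4 \<le> 5"
      "c 0 + c 1 + c 2 + c 4 \<le> 5" "c 0 + c 1 + c 2 + c 3 \<le> 5"
    using key'[of "{1}"] key'[of "{2}"] key'[of "{3}"] key'[of "{4}"] by simp_all
  have two: "3 \<le> c 0 + c 3 + c 4" "3 \<le> c 0 + c 2 + c 4" "3 \<le> c 0 + c 2 + c 3"
      "3 \<le> c 0 + c 1 + c 4" "3 \<le> c 0 + c 1 + c 3" "3 \<le> c 0 + c 1 + c 2"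
    using key'[of "{1, 2}"] key'[of "{1, 3}"] key'[of "{1, 4}"] key'[of "{2, 3}"]
      key'[of "{2, 4}"] key'[of "{3, 4}"] by simp_all
  have "c 1 + c 2 + c 3 + c 4 = 6" "c 0 = 0" using all one by linarith+
  then have "c 1 + c 2 = 3" "c 1 + c 3 = 3" "c 2 + c 3 = 3" using two by linarith+
  then show False by presburger
qed

theorem theorem3p3:
  shows "\<exists>(n::nat) (I :: 'k::field mpoly set).
    squarefree_monomial_ideal n I \<and>
    \<not> (\<forall>s\<ge>1. assrad n (symbolic_power n I s) \<subseteq> assrad n (symbolic_power n I (s + 1))) \<and>
    \<not> (\<forall>s\<ge>1. assrad n (ideal_power (mpoly_ring n) I s)
              \<subseteq> assrad n (ideal_power (mpoly_ring n) I (s + 1)))"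
proof (intro exI conjI)
  show "squarefree_monomial_ideal 5 (veronese_ideal 5 3 1 :: 'k mpoly set)"
    by (rule squarefree_veronese)
  show "\<not> (\<forall>s\<ge>1. assrad 5 (symbolic_power 5 (veronese_ideal 5 3 1 :: 'k mpoly set) s) \<subseteq>
      assrad 5 (symbolic_power 5 (veronese_ideal 5 3 1) (s + 1)))"
    (is "\<not> ?incr")
  proof
    assume ?incr
    from this[rule_format, of 3] symbolic_not_increasing[where ?'k = 'k] show False by simp
  qed
  show "\<not> (\<forall>s\<ge>1. assrad 5 (ideal_power (mpoly_ring 5) (veronese_ideal 5 3 1 :: 'k mpoly set) s) \<subseteq>
      assrad 5 (ideal_power (mpoly_ring 5) (veronese_ideal 5 3 1) (s + 1)))"
    (is "\<not> ?incr")
  proof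
    assume ?incr
    from this[rule_format, of 2] power_not_increasing[where ?'k = 'k] show False by simp
  qed
qed

end
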